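(* There exists a field $F$ that is rootless modtor but such that the abelian group $F^\times/\mu(F)$ is not free abelian.
   Context: For a field $F$, $F^\times$ is its multiplicative group and $\mu(F)$ is the group of roots of unity in $F$, i.e. the torsion subgroup of $F^\times$. An element $a\in F$ that is not a root of unity is rootless modtor (in $F$) if for all but finitely many integers $n\ge 1$, for every root of unity $\zeta \in F$ the equation $x^n=\zeta a$ has no solution in $F$. The field $F$ is rootless modtor if every nonzero $f \in F$ that is not a root of unity is rootless modtor in $F$. *)

theory Defs
  imports "HOL-Algebra.Free_Abelian_Groups" "HOL-Algebra.Multiplicative_Group"
begin

text \<open>The multiplicative group of a field \<open>F\<close> is \<^term>\<open>units_of F\<close>.\<close>

definition roots_of_unity :: "('a, 'm) ring_scheme \<Rightarrow> 'a set" where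
  "roots_of_unity F = {x \<in> carrier F. \<exists>n::nat. n \<ge> 1 \<and> x [^]\<^bsub>F\<^esub> n = \<one>\<^bsub>F\<^esub>}"

definition rootless_modtor_elem :: "('a, 'm) ring_scheme \<Rightarrow> 'a \<Rightarrow> bool" where
  "rootless_modtor_elem F a \<longleftrightarrow>
     a \<in> carrier F \<and> a \<notin> roots_of_unity F \<and>
     finite {n::nat. n \<ge> 1 \<and>
       \<not> (\<forall>\<zeta> \<in> roots_of_unity F. \<not> (\<exists>x \<in> carrier F. x [^]\<^bsub>F\<^esub> n = \<zeta> \<otimes>\<^bsub>F\<^esub> a))}"

definition rootless_modtor :: "('a, 'm) ring_scheme \<Rightarrow> bool" where
  "rootless_modtor F \<longleftrightarrow>
     (\<forall>f \<in> carrier F. f \<noteq> \<zero>\<^bsub>F\<^esub> \<longrightarrow> f \<notin> roots_of_unity F \<longrightarrow> rootless_modtor_elem F f)"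

text \<open>The basis \<open>S\<close> is taken in the element type of \<open>G\<close>, since a type cannot be
  quantified existentially. This is no restriction: see \<open>free_abelianI\<close> below, where the
  basis may have any type.\<close>

definition free_abelian :: "('a, 'm) monoid_scheme \<Rightarrow> bool" where
  "free_abelian G \<longleftrightarrow> (\<exists>S :: 'a set. G \<cong> free_Abelian_group S)"

lemma free_abelianI:
  fixes G :: "('a, 'm) monoid_scheme" and S :: "'b set"
  assumes "group G" "G \<cong> free_Abelian_group S"
  shows "free_abelian G"
proof -
  obtain h where h: "h \<in> iso (free_Abelian_group S) G"
    using group.iso_sym[OF assms] by (auto simp: is_iso_def)
  define T where "T = (\<lambda>s. h (frag_of s)) ` S"
  have "inj_on h (carrier (free_Abelian_group S))"
    using h by (auto simp: iso_def bij_betw_def)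
  then have "inj_on (\<lambda>s. h (frag_of s)) S"
    by (intro inj_onI) (metis frag_of_eq frag_of_in_free_Abelian_group inj_onD)
  then have "S \<approx> T"
    unfolding T_def by (metis eqpoll_sym inj_on_image_eqpoll_self)
  then have "free_Abelian_group S \<cong> free_Abelian_group T"
    by (simp add: isomorphic_free_Abelian_groups)
  with assms(2) have "G \<cong> free_Abelian_group T"
    by (rule iso_trans)
  then show ?thesis
    by (auto simp: free_abelian_def)
qed

lemma units_of_nat_pow: "x [^]\<^bsub>units_of F\<^esub> (n::nat) = x [^]\<^bsub>F\<^esub> n"
  by (simp add: nat_pow_def units_of_def)

lemma (in field) roots_of_unity_eq_torsion:
  "roots_of_unity R = {x \<in> carrier (units_of R). \<exists>n::nat. n \<ge> 1 \<and> x [^]\<^bsub>units_of R\<^esub> n = \<one>\<^bsub>units_of R\<^esub>}"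
proof -
  have "x \<noteq> \<zero>" if "x [^] n = \<one>" "n \<ge> 1" for x and n :: nat
    using that nat_pow_zero[of n] by auto
  then show ?thesis
    by (auto simp: roots_of_unity_def units_of_nat_pow units_of_carrier units_of_one field_Units)
qed

lemma (in field) roots_of_unity_normal: "roots_of_unity R \<lhd> units_of R"
proof -
  interpret U: comm_group "units_of R"
    by (rule units_comm_group)
  have "subgroup (roots_of_unity R) (units_of R)"
  proof (rule U.subgroupI)
    show "roots_of_unity R \<subseteq> carrier (units_of R)"
      by (auto simp: roots_of_unity_eq_torsion)
    have "\<one>\<^bsub>units_of R\<^esub> \<in> roots_of_unity R"
      unfolding roots_of_unity_eq_torsion by (auto intro!: exI[of _ 1])
    then show "roots_of_unity R \<noteq> {}"
      by blast
  next
    fix a assume "a \<in> roots_of_unity R"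
    then show "inv\<^bsub>units_of R\<^esub> a \<in> roots_of_unity R"
      by (auto simp: roots_of_unity_eq_torsion U.nat_pow_inv)
  next
    fix a b assume "a \<in> roots_of_unity R" "b \<in> roots_of_unity R"
    then obtain m n :: nat
      where a: "a \<in> carrier (units_of R)" "m \<ge> 1" "a [^]\<^bsub>units_of R\<^esub> m = \<one>\<^bsub>units_of R\<^esub>"
        and b: "b \<in> carrier (units_of R)" "n \<ge> 1" "b [^]\<^bsub>units_of R\<^esub> n = \<one>\<^bsub>units_of R\<^esub>"
      by (auto simp: roots_of_unity_eq_torsion)
    have "(a \<otimes>\<^bsub>units_of R\<^esub> b) [^]\<^bsub>units_of R\<^esub> (m * n)
        = a [^]\<^bsub>units_of R\<^esub> (m * n) \<otimes>\<^bsub>units_of R\<^esub> b [^]\<^bsub>units_of R\<^esub> (n * m)"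
      using a b by (simp add: U.nat_pow_distrib mult.commute)
    also have "\<dots> = \<one>\<^bsub>units_of R\<^esub>"
      using a b by (simp flip: U.nat_pow_pow)
    finally show "a \<otimes>\<^bsub>units_of R\<^esub> b \<in> roots_of_unity R"
      unfolding roots_of_unity_eq_torsion using a b
      by (auto intro!: exI[of _ "m * n"])
  qed
  then show ?thesis
    by (rule U.subgroup_imp_normal)
qed

end

theory Submission
  imports Defs
    "HOL-Computational_Algebra.Polynomial_Factorial"
    "HOL-Computational_Algebra.Field_as_Ring"
    "HOL-Analysis.Continuum_Not_Denumerable"
begin

text \<open>
  A rank two torsion-free abelian group can fail to be free although each of its nonzero
  elements is divisible by only finitely many integers (Pontryagin). The idea is to adjoin such a group to
  \<open>\<rat>\<close> multiplicatively. Let \<open>x = z\<^sub>0 > 0\<close> be real and let \<open>z\<^bsub>n+1\<^esub>\<close> be the positive real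
  with \<open>z\<^bsub>n+1\<^esub>\<^bsup>2^n\<^esup> = 2 z\<^sub>n\<close>, where \<open>x\<close> is generic in the sense that every \<open>z\<^sub>n\<close> is
  transcendental. The field is the increasing union of the rational function fields \<open>\<rat>(z\<^sub>n)\<close>
  inside \<open>\<real>\<close>, so that its roots of unity are \<open>1\<close> and \<open>-1\<close>. Writing
  \<open>N\<^sub>n = 2^0 2^1 \<cdots> 2^(n-1)\<close> and \<open>b\<^sub>n = N\<^sub>0 + \<cdots> + N\<^bsub>n-1\<^esub>\<close>,
  one has \<open>z\<^sub>n ^ N\<^sub>n = x 2^b\<^sub>n\<close>.

  Both halves of the result rest on one fact, \<open>tower_twist_irrational\<close>: the \<open>2\<close>-adic limit of
  the \<open>b\<^sub>n\<close> is irrational, because \<open>b\<^bsub>n+1\<^esub> / N\<^bsub>n+1\<^esub>\<close> tends to \<open>0\<close> while \<open>b\<^sub>n\<close> grows.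

  Not free: a homomorphism \<open>c\<close> from the multiplicative group to \<open>\<int>\<close> satisfies
  \<open>N\<^sub>n | c(x) + b\<^sub>n c(2)\<close> for all \<open>n\<close>, whence \<open>c(2) = 0\<close>. But in a free abelian group every nontrivial
  element is detected by a homomorphism to \<open>\<int>\<close>, and \<open>2\<close> is not a root of unity.

  Rootless: write \<open>f = p(z\<^sub>n) / q(z\<^sub>n)\<close> with \<open>p\<close>, \<open>q\<close> coprime, and let \<open>f = \<plusminus> g^k\<close>. At a level
  \<open>m\<close> where \<open>g\<close> lives too, \<open>p\<close> and \<open>q\<close> become polynomials in \<open>z\<^sub>m\<close> which are still coprime
  (a Bezout identity persists), so unique factorization makes each of them a constant times a
  \<open>k\<close>-th power. Hence the quotient of the highest and the lowest term of \<open>p\<close> is, up to sign, a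
  \<open>k\<close>-th power among the monomials \<open>c z\<^sub>m^d\<close>; likewise for \<open>q\<close>, and for the highest terms of \<open>p\<close> and \<open>q\<close>.
  If all three quotients were \<open>\<plusminus>1\<close>, then \<open>p\<close> and \<open>q\<close> would be monomials and \<open>f = \<plusminus>1\<close>.
  Otherwise \<open>finite_common_roots\<close>, which says that no monomial other than \<open>\<plusminus>1\<close> is up to sign a \<open>k\<close>-th power of monomials
  for infinitely many \<open>k\<close>, leaves finitely many \<open>k\<close>. The argument there compares
  exponents and \<open>2\<close>-adic valuations of coefficients and again uses irrationality of the limit.
\<close>

hide_const (open) UnivPoly.monom UnivPoly.coeff

section \<open>The tower of exponents\<close>

text \<open>Index and twist are the exponents in \<open>z\<^sub>n ^ tower_index n = x * 2 ^ tower_twist n\<close>. All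
  indices being powers of \<open>2\<close> matters below: it confines divisibility by odd numbers to the exponents
  of a monomial at its original level.\<close>

primrec tower_index :: "nat \<Rightarrow> nat" where
  "tower_index 0 = 1"
| "tower_index (Suc n) = tower_index n * 2 ^ n"

primrec tower_twist :: "nat \<Rightarrow> nat" where
  "tower_twist 0 = 0"
| "tower_twist (Suc n) = tower_twist n + tower_index n"

lemma tower_index_pos: "tower_index n > 0"
  by (induction n) auto

lemma tower_index_power_of_2: "\<exists>e. tower_index n = 2 ^ e"
proof (induction n)
  case 0
  show ?case by (intro exI[of _ 0]) simp
next
  case (Suc n)
  then show ?case by (auto simp flip: power_add)
qed

lemma tower_twist_le_index: "tower_twist n \<le> tower_index n"
proof (induction n)
  case (Suc n)
  show ?case
  proof (cases n)
    case (Suc k)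
    have "tower_twist (Suc n) \<le> tower_index n * 2"
      using Suc.IH by simp
    also have "\<dots> \<le> tower_index n * 2 ^ n"
      using Suc by (intro mult_left_mono) auto
    finally show ?thesis by simp
  qed auto
qed auto

text \<open>If \<open>v\<close> were nonzero, these congruences would make \<open>u / v\<close> the \<open>2\<close>-adic limit of the
  twists. At index \<open>Suc s\<close> the modulus is \<open>2 ^ s\<close> times the index at \<open>s\<close>, whereas the twist is
  at most twice that index; so for large \<open>s\<close> the multiple \<open>u - v * tower_twist (Suc s)\<close> of the
  modulus is smaller than the modulus and must vanish. That is impossible for two consecutive values of \<open>s\<close>.\<close>

lemma tower_twist_irrational:
  fixes u v :: int
  assumes dvd: "\<And>t. t \<ge> n \<Longrightarrow> int (tower_index t) dvd u - v * int (tower_twist t)"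
  shows "v = 0"
proof -
  define t where "t = max n (nat (\<bar>u\<bar> + 2 * \<bar>v\<bar>))"
  have zero: "u = v * int (tower_twist (Suc s))" if "s \<ge> t" for s
  proof -
    have "\<bar>u\<bar> + 2 * \<bar>v\<bar> \<le> int s"
      using that by (auto simp: t_def)
    also have "int s < 2 ^ s"
      by (metis of_nat_less_two_power)
    finally have small: "\<bar>u\<bar> + 2 * \<bar>v\<bar> < 2 ^ s" .
    have "\<bar>u - v * int (tower_twist (Suc s))\<bar> \<le> \<bar>u\<bar> + \<bar>v\<bar> * int (tower_twist (Suc s))"
      by (metis abs_triangle_ineq4 abs_mult abs_of_nat)
    also have "\<dots> \<le> \<bar>u\<bar> * int (tower_index s) + \<bar>v\<bar> * (2 * int (tower_index s))"
    proof (intro add_mono mult_left_mono)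
      show "\<bar>u\<bar> \<le> \<bar>u\<bar> * int (tower_index s)"
        using tower_index_pos[of s] by (simp add: mult_le_cancel_left1)
    qed (use tower_twist_le_index[of s] in auto)
    also have "\<dots> = (\<bar>u\<bar> + 2 * \<bar>v\<bar>) * int (tower_index s)"
      by (simp add: algebra_simps)
    also have "\<dots> < 2 ^ s * int (tower_index s)"
      using small tower_index_pos[of s] by (intro mult_strict_right_mono) auto
    finally have "\<bar>u - v * int (tower_twist (Suc s))\<bar> < int (tower_index (Suc s))"
      by (simp add: mult.commute)
    moreover have "int (tower_index (Suc s)) dvd u - v * int (tower_twist (Suc s))"
      using that by (intro dvd) (auto simp: t_def)
    ultimately show ?thesis
      using zdvd_not_zless[of "\<bar>u - v * int (tower_twist (Suc s))\<bar>" "int (tower_index (Suc s))"]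
      by fastforce
  qed
  have "v * int (tower_index (Suc t)) = 0"
    using zero[of t] zero[of "Suc t"] by (simp add: algebra_simps)
  then show ?thesis
    using tower_index_pos[of "Suc t"] by simp
qed

section \<open>Valuations of rational numbers\<close>

text \<open>The \<open>p\<close>-adic valuation. At \<open>0\<close> it takes the junk value \<open>0\<close>.\<close>

definition rat_val :: "int \<Rightarrow> rat \<Rightarrow> int" where
  "rat_val p q = int (multiplicity p (fst (quotient_of q))) - int (multiplicity p (snd (quotient_of q)))"

lemma rat_val_divide:
  assumes "prime p" "a \<noteq> 0" "b \<noteq> 0"
  shows "rat_val p (of_int a / of_int b) = int (multiplicity p a) - int (multiplicity p b)"
proof -
  obtain c d where cd: "quotient_of (of_int a / of_int b) = (c, d)"
    by (cases "quotient_of (of_int a / of_int b)")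
  have eq: "(of_int a / of_int b :: rat) = of_int c / of_int d" and "d > 0"
    using quotient_of_div[OF cd] quotient_of_denom_pos[OF cd] by auto
  then have "of_int (a * d) = (of_int (c * b) :: rat)"
    using assms by (simp add: field_simps)
  then have ad: "a * d = c * b"
    by (simp only: of_int_eq_iff)
  with assms \<open>d > 0\<close> have "c \<noteq> 0" by auto
  have "multiplicity p a + multiplicity p d = multiplicity p c + multiplicity p b"
    using arg_cong[OF ad, of "multiplicity p"] assms(2,3) \<open>d > 0\<close> \<open>c \<noteq> 0\<close>
    by (simp add: prime_elem_multiplicity_mult_distrib[OF prime_imp_prime_elem[OF assms(1)]])
  then show ?thesis
    by (simp add: rat_val_def cd)
qed

lemma rat_fraction:
  fixes q :: rat
  assumes "q \<noteq> 0"
  obtains a b where "q = of_int a / of_int b" "a \<noteq> 0" "b \<noteq> 0" "coprime a b"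
proof -
  obtain a b where ab: "quotient_of q = (a, b)"
    by (cases "quotient_of q")
  show ?thesis
    using that[of a b] quotient_of_div[OF ab] quotient_of_denom_pos[OF ab] quotient_of_coprime[OF ab]
      assms by auto
qed

lemma rat_val_mult:
  assumes "prime p" "x \<noteq> 0" "y \<noteq> 0"
  shows "rat_val p (x * y) = rat_val p x + rat_val p y"
proof -
  obtain a b where x: "x = of_int a / of_int b" "a \<noteq> 0" "b \<noteq> 0"
    by (rule rat_fraction[OF assms(2)])
  obtain c d where y: "y = of_int c / of_int d" "c \<noteq> 0" "d \<noteq> 0"
    by (rule rat_fraction[OF assms(3)])
  have xy: "x * y = of_int (a * c) / of_int (b * d)"
    by (simp add: x y)
  show ?thesis
    unfolding xy unfolding x(1) y(1) using x(2,3) y(2,3)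
    by (simp add: rat_val_divide[OF assms(1)]
        prime_elem_multiplicity_mult_distrib[OF prime_imp_prime_elem[OF assms(1)]]
        del: of_int_mult times_divide_times_eq)
qed

lemma rat_val_sign:
  assumes "prime p" "\<bar>x\<bar> = 1"
  shows "rat_val p x = 0"
proof -
  have "x = of_int 1 / of_int 1 \<or> x = of_int (-1) / of_int 1"
    using assms(2) by (auto simp: abs_if split: if_splits)
  then show ?thesis
    using rat_val_divide[OF assms(1), of 1 1] rat_val_divide[OF assms(1), of "-1" 1]
      multiplicity_unit_right[of "- 1 :: int" p] by auto
qed

lemma rat_val_power:
  assumes "prime p" "x \<noteq> 0"
  shows "rat_val p (x ^ n) = int n * rat_val p x"
  using assms by (induction n) (auto simp: rat_val_sign rat_val_mult algebra_simps)

lemma rat_val_half: "rat_val 2 (1 / 2) = - 1"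
proof -
  have "rat_val 2 (of_int 1 / of_int 2) = - 1"
    by (subst rat_val_divide) auto
  then show ?thesis by simp
qed

lemma rat_eq_up_to_sign_if_vals_eq:
  fixes x y :: rat
  assumes "x \<noteq> 0" "y \<noteq> 0" and val: "\<And>p. prime p \<Longrightarrow> rat_val p x = rat_val p y"
  shows "\<bar>x\<bar> = \<bar>y\<bar>"
proof -
  obtain a b where ab: "x / y = of_int a / of_int b" "a \<noteq> 0" "b \<noteq> 0" "coprime a b"
    using rat_fraction[of "x / y"] assms by auto
  have mult: "multiplicity p a = multiplicity p b" if "prime p" for p
  proof -
    have "rat_val p x = rat_val p (x / y) + rat_val p y"
      using rat_val_mult[OF that, of "x / y" y] assms by simp
    then show ?thesis
      using val[OF that] ab(1) rat_val_divide[OF that ab(2,3)] by simp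
  qed
  have unit: "is_unit c" if c: "c = a \<or> c = b" for c
  proof (rule ccontr)
    assume "\<not> is_unit c"
    then obtain p where p: "prime p" "p dvd c"
      using ab c prime_divisor_exists by blast
    then have "p dvd a" "p dvd b"
    proof -
      have "p dvd a \<longleftrightarrow> p dvd b"
        using mult[OF p(1)] multiplicity_gt_zero_iff[OF ab(2), of p] 
          multiplicity_gt_zero_iff[OF ab(3), of p] prime_elem_not_unit[OF prime_imp_prime_elem[OF p(1)]]
        by metis
      then show "p dvd a" "p dvd b"
        using p(2) c by auto
    qed
    with ab(4) p show False
      using coprime_common_divisor not_prime_unit by blast
  qed
  then have "\<bar>a\<bar> = 1" "\<bar>b\<bar> = 1"
    by auto
  then have "\<bar>x / y\<bar> = 1"
    unfolding ab(1) by (simp flip: of_int_abs)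
  then show ?thesis
    using assms by (simp add: abs_divide)
qed


lemma rat_val_abs_cong:
  assumes "prime p" "x \<noteq> 0" "\<bar>x\<bar> = \<bar>y\<bar>"
  shows "rat_val p x = rat_val p y"
proof -
  have "x = y \<or> x = (- 1) * y"
    using assms(3) by (auto simp: abs_eq_iff)
  then show ?thesis
    using rat_val_mult[OF assms(1), of "- 1" y] rat_val_sign[OF assms(1), of "- 1"] assms(2) by auto
qed

text \<open>Powers of \<open>1 / 2\<close> enter because \<open>z\<^sub>n = (1 / 2) ^ \<beta> * z\<^sub>m ^ M\<close>: rewriting a monomial at a higher
  level multiplies its coefficient by such a power.\<close>

lemma rat_val_twisted_power:
  assumes "prime p" "q \<noteq> 0" "c \<noteq> 0" "r \<noteq> 0"
      and "q * (1 / 2) ^ e = c * r ^ k"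
  shows "rat_val p q + int e * rat_val p (1 / 2) = rat_val p c + int k * rat_val p r"
  using arg_cong[OF assms(5), of "rat_val p"] assms(1-4)
  by (simp add: rat_val_mult rat_val_power)

section \<open>Divisibility in the group of monomials\<close>

text \<open>The monomials \<open>q1 z\<^sub>n^d1\<close> and \<open>q2 z\<^sub>n^d2\<close>, rewritten at some level \<open>m\<close>, are \<open>k\<close>-th powers of
  monomials up to constants \<open>c1\<close> and \<open>c2\<close>. As these agree up to sign, the quotient of the two
  monomials is a \<open>k\<close>-th power up to sign. Using two terms instead of their quotient keeps all
  exponents natural numbers.\<close>

definition common_root :: "nat \<Rightarrow> rat \<Rightarrow> nat \<Rightarrow> rat \<Rightarrow> nat \<Rightarrow> nat \<Rightarrow> bool" where
  "common_root n q1 d1 q2 d2 k \<longleftrightarrow>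
     (\<exists>m M \<beta> c1 c2 r1 r2 e1 e2.
        tower_index m = tower_index n * M \<and> tower_twist m = tower_twist n + tower_index n * \<beta> \<and>
        c1 \<noteq> 0 \<and> \<bar>c1\<bar> = \<bar>c2\<bar> \<and> r1 \<noteq> 0 \<and> r2 \<noteq> 0 \<and> M * d1 = k * e1 \<and> M * d2 = k * e2 \<and>
        q1 * (1 / 2) ^ (\<beta> * d1) = c1 * r1 ^ k \<and> q2 * (1 / 2) ^ (\<beta> * d2) = c2 * r2 ^ k)"

lemma tower_step:
  assumes "t \<le> m"
  shows "\<exists>M \<beta>. tower_index m = tower_index t * M \<and> tower_twist m = tower_twist t + tower_index t * \<beta>"
  using assms
proof (induction m rule: dec_induct)
  case base
  show ?case by (intro exI[of _ 1] exI[of _ 0]) simp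
next
  case (step m)
  then obtain M \<beta> where
    "tower_index m = tower_index t * M" "tower_twist m = tower_twist t + tower_index t * \<beta>"
    by auto
  then show ?case
    by (intro exI[of _ "M * 2 ^ m"] exI[of _ "\<beta> + M"]) (simp add: algebra_simps)
qed

lemma finite_divisors_int:
  fixes D :: int
  assumes "D \<noteq> 0"
  shows "finite {k::nat. int k dvd D}"
proof (rule finite_subset)
  show "{k::nat. int k dvd D} \<subseteq> {..nat \<bar>D\<bar>}"
  proof
    fix k assume "k \<in> {k::nat. int k dvd D}"
    then have "\<bar>int k\<bar> \<le> \<bar>D\<bar>"
      using dvd_imp_le_int[OF assms, of "int k"] by simp
    then show "k \<in> {..nat \<bar>D\<bar>}"
      by (simp add: le_nat_iff)
  qed
qed auto

text \<open>For equal exponents the twists by powers of \<open>1 / 2\<close> cancel, and an ordinary valuation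
  bounds \<open>k\<close>.\<close>

lemma common_root_divides_val:
  assumes "common_root n q1 d q2 d k" "q1 \<noteq> 0" "q2 \<noteq> 0" "prime p"
  shows "int k dvd rat_val p q1 - rat_val p q2"
proof -
  obtain e c1 c2 r1 r2 where c: "c1 \<noteq> 0" "\<bar>c1\<bar> = \<bar>c2\<bar>" and r: "r1 \<noteq> 0" "r2 \<noteq> 0"
    and q: "q1 * (1 / 2) ^ e = c1 * r1 ^ k" "q2 * (1 / 2) ^ e = c2 * r2 ^ k"
    using assms(1) unfolding common_root_def by blast
  have "c2 \<noteq> 0" using c by auto
  have "rat_val p q1 - rat_val p q2 = int k * (rat_val p r1 - rat_val p r2)"
    using rat_val_twisted_power[OF assms(4,2) c(1) r(1) q(1)]
      rat_val_twisted_power[OF assms(4,3) \<open>c2 \<noteq> 0\<close> r(2) q(2)]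
      rat_val_abs_cong[OF assms(4) c]
    by (simp add: algebra_simps)
  then show ?thesis by simp
qed

lemma common_root_divides_exponents:
  assumes "common_root n q1 d1 q2 d2 k" "q1 \<noteq> 0" "q2 \<noteq> 0"
  obtains m M \<beta> where
    "tower_index m = tower_index n * M" "tower_twist m = tower_twist n + tower_index n * \<beta>"
    "int k dvd (int d1 - int d2) * int M"
    "int k dvd rat_val 2 q1 - rat_val 2 q2 - (int d1 - int d2) * int \<beta>"
proof -
  obtain m M \<beta> c1 c2 r1 r2 e1 e2 where
    m: "tower_index m = tower_index n * M" "tower_twist m = tower_twist n + tower_index n * \<beta>"
    and c: "c1 \<noteq> 0" "\<bar>c1\<bar> = \<bar>c2\<bar>" and r: "r1 \<noteq> 0" "r2 \<noteq> 0"
    and e: "M * d1 = k * e1" "M * d2 = k * e2"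
    and q: "q1 * (1 / 2) ^ (\<beta> * d1) = c1 * r1 ^ k" "q2 * (1 / 2) ^ (\<beta> * d2) = c2 * r2 ^ k"
    using assms(1) unfolding common_root_def by blast
  have "c2 \<noteq> 0" using c by auto
  have two: "prime (2::int)" by simp
  have "int M * int d1 = int k * int e1" "int M * int d2 = int k * int e2"
    using e by (metis of_nat_mult)+
  then have "(int d1 - int d2) * int M = int k * (int e1 - int e2)"
    by (simp add: algebra_simps)
  moreover have "rat_val 2 q1 - rat_val 2 q2 - (int d1 - int d2) * int \<beta>
      = int k * (rat_val 2 r1 - rat_val 2 r2)"
    using rat_val_twisted_power[OF two assms(2) c(1) r(1) q(1)]
      rat_val_twisted_power[OF two assms(3) \<open>c2 \<noteq> 0\<close> r(2) q(2)]
      rat_val_abs_cong[OF two c]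
    by (simp add: algebra_simps rat_val_half)
  ultimately show ?thesis
    using that[OF m] by simp
qed

text \<open>For distinct exponents put \<open>j = d1 - d2\<close>, and suppose that \<open>k\<close> is unbounded. Since \<open>k\<close> divides
  \<open>j M\<close>, and \<open>M\<close> is a power of \<open>2\<close>, the power of \<open>2\<close> in \<open>k\<close> is unbounded. The valuation at \<open>2\<close>
  then makes the limit of the twists rational, contrary to
  \<open>tower_twist_irrational\<close>.\<close>

lemma finite_common_roots:
  assumes "q1 \<noteq> 0" "q2 \<noteq> 0" and neq: "\<not> (d1 = d2 \<and> \<bar>q1\<bar> = \<bar>q2\<bar>)"
  shows "finite {k. k \<ge> 1 \<and> common_root n q1 d1 q2 d2 k}" (is "finite ?K")
proof (cases "d1 = d2")
  case True
  then obtain p where p: "prime p" "rat_val p q1 - rat_val p q2 \<noteq> 0"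
    using rat_eq_up_to_sign_if_vals_eq[OF assms(1,2)] neq by fastforce
  show ?thesis
  proof (rule finite_subset[OF _ finite_divisors_int[OF p(2)]])
    show "?K \<subseteq> {k. int k dvd rat_val p q1 - rat_val p q2}"
      using common_root_divides_val[of n q1 d1 q2 _ p] assms p True by auto
  qed
next
  case False
  define j where "j = int d1 - int d2"
  define V where "V = rat_val 2 q1 - rat_val 2 q2"
  have "j \<noteq> 0" using False by (simp add: j_def)
  show ?thesis
  proof (rule ccontr)
    assume inf: "infinite ?K"
    have "j = 0"
    proof (rule tower_twist_irrational)
      fix t assume "t \<ge> n"
      \<comment> \<open>One factor \<open>\<bar>j\<bar>\<close> is lost in passing to \<open>gcd k M\<close>.\<close>
      obtain k where k: "k \<in> ?K" "k > nat \<bar>j\<bar> * (nat \<bar>j\<bar> * tower_index t)"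
        using inf by (meson finite_nat_set_iff_bounded_le linorder_not_le)
      then obtain m M \<beta> where
        m: "tower_index m = tower_index n * M" "tower_twist m = tower_twist n + tower_index n * \<beta>"
        and jM: "int k dvd j * int M" and V: "int k dvd V - j * int \<beta>"
        using common_root_divides_exponents[OF _ assms(1,2)] unfolding j_def V_def by blast
      \<comment> \<open>Essentially the \<open>2\<close>-part of \<open>k\<close>: as \<open>k\<close> divides \<open>j M\<close>, the cofactor is at most \<open>\<bar>j\<bar>\<close>.\<close>
      define g where "g = gcd k M"
      have "M > 0" using m(1) tower_index_pos[of m] by (cases M) auto
      have "gcd (j * int k) (j * int M) = \<bar>j\<bar> * int g"
        unfolding g_def by (simp add: gcd_mult_distrib_int[symmetric])
      moreover have "int k dvd gcd (j * int k) (j * int M)"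
        using jM by simp
      ultimately have "int k dvd \<bar>j\<bar> * int g"
        by simp
      moreover have "\<bar>j\<bar> * int g > 0"
        using \<open>j \<noteq> 0\<close> \<open>M > 0\<close> by (simp add: g_def)
      ultimately have k_le: "int k \<le> \<bar>j\<bar> * int g"
        by (rule zdvd_imp_le)
      have k_gt: "int k > \<bar>j\<bar> * (\<bar>j\<bar> * int (tower_index t))"
      proof -
        have "int (nat \<bar>j\<bar> * (nat \<bar>j\<bar> * tower_index t)) < int k"
          using k(2) by (simp only: of_nat_less_iff)
        then show ?thesis by simp
      qed
      have g_large: "\<bar>j\<bar> * int (tower_index t) < int g"
      proof -
        have "\<bar>j\<bar> * (\<bar>j\<bar> * int (tower_index t)) < \<bar>j\<bar> * int g"
          using k_le k_gt by linarith
        then show ?thesis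
          using \<open>j \<noteq> 0\<close> by (simp only: mult_less_cancel_left_pos zero_less_abs_iff not_False_eq_True)
      qed
      moreover have "int (tower_index t) \<le> \<bar>j\<bar> * int (tower_index t)"
        using \<open>j \<noteq> 0\<close> mult_right_mono[of 1 "\<bar>j\<bar>" "int (tower_index t)"] by simp
      ultimately have g_gt: "tower_index t < g" by linarith
      have "g dvd tower_index m"
        unfolding m(1) g_def by simp
      then obtain a where a: "g = 2 ^ a"
        using tower_index_power_of_2[of m] by (metis divides_primepow_nat two_is_prime_nat)
      obtain b where b: "tower_index t = 2 ^ b"
        using tower_index_power_of_2 by blast
      have t_dvd_g: "tower_index t dvd g"
        using g_gt unfolding a b by (simp add: le_imp_power_dvd)
      have "g \<le> tower_index m"
        using \<open>g dvd tower_index m\<close> tower_index_pos by (simp add: dvd_imp_le)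
      with g_gt have "tower_index t < tower_index m" by simp
      have "t \<le> m"
      proof (rule ccontr)
        assume "\<not> t \<le> m"
        then obtain M' where "tower_index t = tower_index m * M'"
          using tower_step[of m t] by auto
        then show False
          using \<open>tower_index t < tower_index m\<close> tower_index_pos[of t] by auto
      qed
      then obtain \<gamma> where \<gamma>: "tower_twist m = tower_twist t + tower_index t * \<gamma>"
        using tower_step by blast
      have "int (tower_index t) dvd int k"
        using t_dvd_g by (auto simp: g_def)
      with V have "int (tower_index t) dvd V - j * int \<beta>"
        by (rule dvd_trans[rotated])
      then have "int (tower_index t) dvd
          int (tower_index n) * (V - j * int \<beta>) + j * (int (tower_index t) * int \<gamma>)"
        by simp
      also have "int (tower_index n) * (V - j * int \<beta>) + j * (int (tower_index t) * int \<gamma>)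
          = (V * int (tower_index n) + j * int (tower_twist n)) - j * int (tower_twist t)"
      proof -
        have "int (tower_twist n) + int (tower_index n) * int \<beta>
            = int (tower_twist t) + int (tower_index t) * int \<gamma>"
          using m(2) \<gamma> by (metis of_nat_add of_nat_mult)
        then have "j * (int (tower_twist n) + int (tower_index n) * int \<beta>)
            = j * (int (tower_twist t) + int (tower_index t) * int \<gamma>)"
          by simp
        then show ?thesis by (simp add: algebra_simps)
      qed
      finally show "int (tower_index t) dvd
          (V * int (tower_index n) + j * int (tower_twist n)) - j * int (tower_twist t)" .
    qed
    with \<open>j \<noteq> 0\<close> show False by simp
  qed
qed

section \<open>Rational polynomials under stretching\<close>

text \<open>If \<open>z\<^sub>n = (1 / 2) ^ \<beta> * z\<^sub>m ^ M\<close>, this turns a polynomial in \<open>z\<^sub>n\<close> into the polynomial in \<open>z\<^sub>m\<close> with the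
  same value.\<close>

definition stretch :: "nat \<Rightarrow> nat \<Rightarrow> rat poly \<Rightarrow> rat poly" where
  "stretch M \<beta> p = pcompose p (monom ((1 / 2) ^ \<beta>) M)"

lemma degree_stretch: "degree (stretch M \<beta> p) = M * degree p"
  by (simp add: stretch_def degree_pcompose degree_monom_eq)

lemma lead_coeff_stretch:
  assumes "M > 0"
  shows "lead_coeff (stretch M \<beta> p) = lead_coeff p * (1 / 2) ^ (\<beta> * degree p)"
proof -
  have "degree (monom ((1 / 2 :: rat) ^ \<beta>) M) > 0"
    using assms by (simp add: degree_monom_eq)
  then show ?thesis
    unfolding stretch_def by (subst lead_coeff_comp) (simp_all add: degree_monom_eq power_mult)
qed

lemma stretch_nonzero:
  assumes "M > 0" "p \<noteq> 0"
  shows "stretch M \<beta> p \<noteq> 0"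
  using assms pcompose_eq_0_iff[of "monom ((1 / 2 :: rat) ^ \<beta>) M" p]
  by (simp add: stretch_def degree_monom_eq)

text \<open>Being a ring homomorphism, \<^const>\<open>stretch\<close> carries a Bezout identity to a Bezout
  identity.\<close>

lemma coprime_stretch:
  assumes "coprime p q"
  shows "coprime (stretch M \<beta> p) (stretch M \<beta> q)"
proof -
  obtain a b where "a * p + b * q = gcd p q"
    using bezout_coefficients_fst_snd[of p q] by blast
  then have "a * p + b * q = 1"
    using assms by (simp add: coprime_iff_gcd_eq_1)
  then have eq: "stretch M \<beta> a * stretch M \<beta> p + stretch M \<beta> b * stretch M \<beta> q = 1"
    by (simp add: stretch_def flip: pcompose_mult pcompose_add) (simp add: pcompose_1)
  show ?thesis
  proof (rule coprimeI)
    fix d assume "d dvd stretch M \<beta> p" "d dvd stretch M \<beta> q"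
    then have "d dvd stretch M \<beta> a * stretch M \<beta> p + stretch M \<beta> b * stretch M \<beta> q"
      by simp
    then show "is_unit d"
      unfolding eq .
  qed
qed

text \<open>A relation rather than a function: existence and uniqueness, together with its
  compatibility with products and substitution, are immediate from the factorization.\<close>

definition lowest_term :: "'a::field poly \<Rightarrow> 'a \<Rightarrow> nat \<Rightarrow> bool" where
  "lowest_term p c d \<longleftrightarrow> c \<noteq> 0 \<and> (\<exists>p0. p = monom c d * p0 \<and> poly p0 0 = 1)"

lemma lowest_term_exists: "p \<noteq> 0 \<Longrightarrow> \<exists>c d. lowest_term p c d"
proof (induction p)
  case (pCons a p)
  show ?case
  proof (cases "a = 0")
    case True
    with pCons obtain c d p0 where "c \<noteq> 0" "p = monom c d * p0" "poly p0 0 = 1"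
      by (auto simp: lowest_term_def)
    then have "lowest_term (pCons a p) c (Suc d)"
      unfolding lowest_term_def using True by (auto simp: monom_Suc)
    then show ?thesis by blast
  next
    case False
    then have "lowest_term (pCons a p) a 0"
      unfolding lowest_term_def
      by (auto simp: monom_0 intro!: exI[of _ "smult (1 / a) (pCons a p)"])
    then show ?thesis by blast
  qed
qed simp

lemma lowest_term_coeff:
  assumes "lowest_term p c d"
  shows "coeff p d = c" "\<And>i. i < d \<Longrightarrow> coeff p i = 0"
  using assms by (auto simp: lowest_term_def coeff_monom_mult poly_0_coeff_0)

lemma lowest_term_unique:
  assumes "lowest_term p c d" "lowest_term p c' d'"
  shows "c = c' \<and> d = d'"
proof -
  have "c \<noteq> 0" "c' \<noteq> 0"
    using assms by (auto simp: lowest_term_def)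
  then have "\<not> d < d'" "\<not> d' < d"
    using lowest_term_coeff[OF assms(1)] lowest_term_coeff[OF assms(2)] by auto
  then show ?thesis
    using lowest_term_coeff[OF assms(1)] lowest_term_coeff[OF assms(2)] by auto
qed

lemma lowest_term_degree:
  assumes "lowest_term p c d" "degree p = d"
  shows "p = monom (lead_coeff p) (degree p)"
proof (rule poly_eqI)
  fix i
  consider "i < d" | "i = d" | "i > d" by linarith
  then show "coeff p i = coeff (monom (lead_coeff p) (degree p)) i"
    using lowest_term_coeff(2)[OF assms(1)] assms(2) by cases (auto simp: coeff_eq_0)
qed

lemma pcompose_power: "pcompose (p ^ n) q = pcompose p q ^ n"
  by (induction n) (simp_all add: pcompose_1 pcompose_mult)

lemma pcompose_monom: "pcompose (monom c d) q = smult c (q ^ d)"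
  by (simp add: monom_altdef pcompose_smult pcompose_power pcompose_pCons)

lemma lowest_term_stretch:
  assumes "lowest_term p c d" "M > 0"
  shows "lowest_term (stretch M \<beta> p) (c * (1 / 2) ^ (\<beta> * d)) (M * d)"
proof -
  obtain p0 where p0: "c \<noteq> 0" "p = monom c d * p0" "poly p0 0 = 1"
    using assms by (auto simp: lowest_term_def)
  have "stretch M \<beta> p = monom (c * (1 / 2) ^ (\<beta> * d)) (M * d) * stretch M \<beta> p0"
    by (simp add: stretch_def p0(2) pcompose_mult pcompose_monom monom_power smult_monom power_mult)
  moreover have "poly (stretch M \<beta> p0) 0 = 1"
    using assms(2) p0(3) by (simp add: stretch_def poly_pcompose poly_monom zero_power)
  ultimately show ?thesis
    using p0(1) unfolding lowest_term_def by auto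
qed

lemma lowest_term_smult_power:
  assumes "lowest_term r c d" "a \<noteq> 0"
  shows "lowest_term (smult a (r ^ k)) (a * c ^ k) (k * d)"
proof -
  obtain r0 where r0: "c \<noteq> 0" "r = monom c d * r0" "poly r0 0 = 1"
    using assms by (auto simp: lowest_term_def)
  have "smult a (r ^ k) = smult a (monom (c ^ k) (d * k)) * r0 ^ k"
    by (simp add: r0(2) power_mult_distrib monom_power)
  also have "smult a (monom (c ^ k) (d * k)) = monom (a * c ^ k) (k * d)"
    by (simp add: smult_monom mult.commute)
  finally show ?thesis
    using assms(2) r0 unfolding lowest_term_def by (auto simp: poly_power)
qed

text \<open>Highest and lowest terms are multiplicative, so a polynomial equation \<open>p = a r^k\<close> can be
  read off at both ends of the Newton polygon.\<close>

lemma stretch_power_terms: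
  assumes eq: "stretch M \<beta> p = smult a (r ^ k)" and "M > 0" "r \<noteq> 0" "a \<noteq> 0"
    and low: "lowest_term p c d"
  obtains r1 e1 r2 e2 where "r1 \<noteq> 0" "r2 \<noteq> 0" "M * degree p = k * e1" "M * d = k * e2"
    "lead_coeff p * (1 / 2) ^ (\<beta> * degree p) = a * r1 ^ k" "c * (1 / 2) ^ (\<beta> * d) = a * r2 ^ k"
proof -
  obtain r2 e2 where r2: "lowest_term r r2 e2"
    using lowest_term_exists[OF \<open>r \<noteq> 0\<close>] by blast
  have "c * (1 / 2) ^ (\<beta> * d) = a * r2 ^ k \<and> M * d = k * e2"
    using lowest_term_unique[OF lowest_term_stretch[OF low \<open>M > 0\<close>, of \<beta>, unfolded eq]
        lowest_term_smult_power[OF r2 \<open>a \<noteq> 0\<close>]] .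
  moreover have "M * degree p = k * degree r"
    using arg_cong[OF eq, of degree] \<open>a \<noteq> 0\<close> \<open>r \<noteq> 0\<close> by (simp add: degree_stretch degree_power_eq)
  moreover have "lead_coeff p * (1 / 2) ^ (\<beta> * degree p) = a * lead_coeff r ^ k"
    using arg_cong[OF eq, of lead_coeff] lead_coeff_stretch[OF \<open>M > 0\<close>, of \<beta> p]
    by (simp add: lead_coeff_power)
  moreover have "r2 \<noteq> 0" "lead_coeff r \<noteq> 0"
    using r2 \<open>r \<noteq> 0\<close> by (auto simp: lowest_term_def)
  ultimately show ?thesis using that by blast
qed

text \<open>The equation says \<open>p / q = \<epsilon> (r / s)^k\<close> with both fractions in lowest terms; so numerators
  and denominators agree up to constants.\<close>

lemma coprime_power_equation:
  fixes p q r s :: "rat poly"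
  assumes "coprime p q" "coprime r s" "p \<noteq> 0" "r \<noteq> 0" "s \<noteq> 0"
    and eq: "p * s ^ k = smult \<epsilon> (q * r ^ k)"
    and "\<epsilon> \<noteq> 0"
  obtains c where "c \<noteq> 0" "p = smult c (r ^ k)" "q = smult (c / \<epsilon>) (s ^ k)"
proof -
  have "p dvd smult \<epsilon> (q * r ^ k)"
    by (metis dvd_triv_left eq)
  then have "p dvd r ^ k"
    using \<open>\<epsilon> \<noteq> 0\<close> assms(1) by (simp add: dvd_smult_iff coprime_dvd_mult_right_iff)
  have "r ^ k dvd p * s ^ k"
    unfolding eq by (simp add: dvd_smult)
  moreover have "coprime (r ^ k) (s ^ k)"
    using assms(2) by simp
  ultimately have "r ^ k dvd p"
    by (simp add: coprime_dvd_mult_left_iff)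
  then obtain u where u: "p = r ^ k * u" by blast
  have "u dvd 1"
    using \<open>p dvd r ^ k\<close> u assms(3) by (metis dvd_mult_cancel_left mult.right_neutral mult_zero_left)
  then obtain c where c: "u = [:c:]" "c \<noteq> 0"
    by (auto simp: is_unit_poly_iff dvd_field_iff)
  have p: "p = smult c (r ^ k)"
    using u c by simp
  have "r ^ k * smult c (s ^ k) = r ^ k * smult \<epsilon> q"
    using eq unfolding p by (simp add: mult_ac)
  then have "smult c (s ^ k) = smult \<epsilon> q"
    by (rule mult_left_cancel[THEN iffD1, rotated]) (use assms(4) in simp)
  then have "smult \<epsilon> q = smult c (s ^ k)"
    by simp
  then have "smult (1 / \<epsilon>) (smult \<epsilon> q) = smult (1 / \<epsilon>) (smult c (s ^ k))"
    by simp
  then have "q = smult (c / \<epsilon>) (s ^ k)"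
    using \<open>\<epsilon> \<noteq> 0\<close> by simp
  with p c show ?thesis using that by blast
qed

section \<open>Evaluation at real numbers\<close>

definition rat_eval :: "real \<Rightarrow> rat poly \<Rightarrow> real" where
  "rat_eval z p = poly (map_poly of_rat p) z"

lemma rat_eval_pCons: "rat_eval z (pCons a p) = of_rat a + z * rat_eval z p"
  by (simp add: rat_eval_def map_poly_pCons)

lemma rat_eval_0 [simp]: "rat_eval z 0 = 0"
  by (simp add: rat_eval_def)

lemma rat_eval_1 [simp]: "rat_eval z 1 = 1"
  by (simp add: rat_eval_pCons flip: pCons_one)

lemma rat_eval_add: "rat_eval z (p + q) = rat_eval z p + rat_eval z q"
proof (induction p arbitrary: q)
  case (pCons a p)
  then show ?case
    by (cases q) (simp add: rat_eval_pCons of_rat_add algebra_simps)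
qed simp

lemma rat_eval_smult: "rat_eval z (smult c p) = of_rat c * rat_eval z p"
  by (induction p) (simp_all add: rat_eval_pCons of_rat_mult algebra_simps)

lemma rat_eval_mult: "rat_eval z (p * q) = rat_eval z p * rat_eval z q"
  by (induction p)
     (simp_all add: rat_eval_pCons rat_eval_add rat_eval_smult algebra_simps)

lemma rat_eval_power: "rat_eval z (p ^ k) = rat_eval z p ^ k"
  by (induction k) (simp_all add: rat_eval_mult)

lemma rat_eval_monom: "rat_eval z (monom c n) = of_rat c * z ^ n"
  by (simp add: rat_eval_def map_poly_monom poly_monom)

lemma rat_eval_pcompose: "rat_eval z (pcompose p q) = rat_eval (rat_eval z q) p"
  by (induction p) (simp_all add: rat_eval_pCons rat_eval_add rat_eval_mult pcompose_pCons)

lemma rat_eval_diff: "rat_eval z (p - q) = rat_eval z p - rat_eval z q"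
  using rat_eval_add[of z "p - q" q] by simp

lemma countable_rat_poly: "countable (UNIV :: rat poly set)"
proof -
  have "(UNIV :: rat poly set) = range Poly"
    by (metis Poly_coeffs surjI surj_def)
  then show ?thesis
    by (metis countable_image countableI_type)
qed

lemma countable_algebraic: "countable {z. \<exists>p. p \<noteq> 0 \<and> rat_eval z p = 0}"
proof -
  have "{z. \<exists>p. p \<noteq> 0 \<and> rat_eval z p = 0} = (\<Union>p\<in>UNIV - {0}. {z. poly (map_poly of_rat p) z = 0})"
    by (auto simp: rat_eval_def)
  moreover have "countable \<dots>"
  proof (rule countable_UN)
    show "countable (UNIV - {0 :: rat poly})"
      using countable_rat_poly by blast
    fix p :: "rat poly" assume "p \<in> UNIV - {0}"
    then have "map_poly (of_rat :: rat \<Rightarrow> real) p \<noteq> 0"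
      by (simp add: map_poly_eq_0_iff)
    then show "countable {z :: real. poly (map_poly of_rat p) z = 0}"
      using poly_roots_finite countable_finite by blast
  qed
  ultimately show ?thesis by simp
qed

primrec root_tower :: "real \<Rightarrow> nat \<Rightarrow> real" where
  "root_tower x 0 = x"
| "root_tower x (Suc n) = root (2 ^ n) (2 * root_tower x n)"

lemma root_tower_pos: "x > 0 \<Longrightarrow> root_tower x n > 0"
  by (induction n) auto

lemma root_tower_Suc_power:
  assumes "x > 0"
  shows "root_tower x (Suc n) ^ 2 ^ n = 2 * root_tower x n"
  using root_tower_pos[OF assms, of n] by (simp add: real_root_pow_pos2)

lemma inj_on_root_tower: "inj_on (\<lambda>x. root_tower x n) {0<..}"
proof (induction n)
  case (Suc n)
  show ?case
  proof (rule inj_onI)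
    fix x y :: real assume xy: "x \<in> {0<..}" "y \<in> {0<..}" "root_tower x (Suc n) = root_tower y (Suc n)"
    then have "2 * root_tower x n = 2 * root_tower y n"
      using root_tower_Suc_power[of x n] root_tower_Suc_power[of y n] by simp
    then show "x = y"
      using Suc xy by (auto dest: inj_onD)
  qed
qed simp

lemma root_tower_step:
  assumes "n \<le> m" "x > 0"
  shows "\<exists>M \<beta>. M > 0 \<and> tower_index m = tower_index n * M \<and>
    tower_twist m = tower_twist n + tower_index n * \<beta> \<and>
    root_tower x n = (1 / 2) ^ \<beta> * root_tower x m ^ M"
  using assms(1)
proof (induction m rule: dec_induct)
  case base
  show ?case by (intro exI[of _ 1] exI[of _ 0]) simp
next
  case (step m)
  then obtain M \<beta> where M: "M > 0" "tower_index m = tower_index n * M"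
    "tower_twist m = tower_twist n + tower_index n * \<beta>"
    "root_tower x n = (1 / 2) ^ \<beta> * root_tower x m ^ M"
    by auto
  have "root_tower x m = (1 / 2) * root_tower x (Suc m) ^ 2 ^ m"
    using root_tower_Suc_power[OF assms(2), of m] by (simp del: root_tower.simps)
  then have "root_tower x n = (1 / 2) ^ \<beta> * ((1 / 2) * root_tower x (Suc m) ^ 2 ^ m) ^ M"
    using M(4) by (simp only:)
  then have "root_tower x n = (1 / 2) ^ (\<beta> + M) * root_tower x (Suc m) ^ (M * 2 ^ m)"
    by (simp only: power_mult_distrib power_add power_mult[symmetric] mult.assoc mult.commute[of M])
  with M(1-3) show ?case
    by (intro exI[of _ "M * 2 ^ m"] exI[of _ "\<beta> + M"]) (simp add: algebra_simps)
qed

lemma root_tower_power: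
  assumes "x > 0"
  shows "root_tower x n ^ tower_index n = x * 2 ^ tower_twist n"
proof -
  obtain M \<beta> where M: "tower_index n = M" "tower_twist n = \<beta>"
    and x: "x = (1 / 2) ^ \<beta> * root_tower x n ^ M"
    using root_tower_step[of 0 n x] assms by auto
  show ?thesis
    unfolding M by (subst (2) x) (simp add: power_divide)
qed

text \<open>Each \<open>z\<^sub>n\<close> is an injective function of \<open>x\<close>, so only countably many \<open>x\<close> make some \<open>z\<^sub>n\<close>
  algebraic.\<close>

lemma generic_base_exists:
  "\<exists>x>0. \<forall>n p. rat_eval (root_tower x n) p = 0 \<longrightarrow> p = 0"
proof (rule ccontr)
  assume "\<not> ?thesis"
  then have "{0<..} \<subseteq> (\<Union>n. {x \<in> {0<..}. root_tower x n \<in> {z. \<exists>p. p \<noteq> 0 \<and> rat_eval z p = 0}})"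
    by (auto; metis)
  moreover have "countable {x \<in> {0<..}. root_tower x n \<in> {z. \<exists>p. p \<noteq> 0 \<and> rat_eval z p = 0}}" for n
  proof (rule countable_image_inj_on)
    show "inj_on (\<lambda>x. root_tower x n) {x \<in> {0<..}. root_tower x n \<in> {z. \<exists>p. p \<noteq> 0 \<and> rat_eval z p = 0}}"
      by (rule inj_on_subset[OF inj_on_root_tower]) auto
    show "countable ((\<lambda>x. root_tower x n) ` {x \<in> {0<..}. root_tower x n \<in> {z. \<exists>p. p \<noteq> 0 \<and> rat_eval z p = 0}})"
      by (rule countable_subset[OF _ countable_algebraic]) auto
  qed
  ultimately have "countable {0::real<..}"
    by (meson countable_UN countable_subset countableI_type)
  then have "countable {0::real<..<1}"
    by (rule countable_subset[rotated]) auto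
  then show False
    using uncountable_open_interval[of 0 "1::real"] by simp
qed


section \<open>The field\<close>

locale generic_tower =
  fixes x :: real
  assumes x_pos: "x > 0"
    and generic: "rat_eval (root_tower x n) p = 0 \<Longrightarrow> p = 0"
begin

abbreviation ev :: "nat \<Rightarrow> rat poly \<Rightarrow> real" where
  "ev n \<equiv> rat_eval (root_tower x n)"

definition tower_field :: "real set" where
  "tower_field = {ev n p / ev n q | n p q. q \<noteq> 0}"

lemma ev_eq_0_iff [simp]: "ev n p = 0 \<longleftrightarrow> p = 0"
  using generic by auto

lemma ev_eq_iff: "ev n p = ev n q \<longleftrightarrow> p = q"
  using ev_eq_0_iff[of n "p - q"] by (simp only: rat_eval_diff right_minus_eq)

lemma ev_lift:
  assumes "n \<le> m"
  obtains M \<beta> where "M > 0" "tower_index m = tower_index n * M"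
    "tower_twist m = tower_twist n + tower_index n * \<beta>" "\<And>p. ev n p = ev m (stretch M \<beta> p)"
proof -
  obtain M \<beta> where M: "M > 0" "tower_index m = tower_index n * M"
    "tower_twist m = tower_twist n + tower_index n * \<beta>"
    "root_tower x n = (1 / 2) ^ \<beta> * root_tower x m ^ M"
    using root_tower_step[OF assms x_pos] by blast
  have "ev n p = ev m (stretch M \<beta> p)" for p
    by (simp add: stretch_def rat_eval_pcompose rat_eval_monom M(4) of_rat_power of_rat_divide)
  with M show ?thesis using that by blast
qed

lemma tower_fieldI: "q \<noteq> 0 \<Longrightarrow> ev n p / ev n q \<in> tower_field"
  unfolding tower_field_def by blast

lemma tower_field_common_level:
  assumes "f \<in> tower_field" "g \<in> tower_field"
  obtains n p q r s where "f = ev n p / ev n q" "g = ev n r / ev n s" "q \<noteq> 0" "s \<noteq> 0"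
proof -
  obtain n1 p q n2 r s where f: "f = ev n1 p / ev n1 q" "q \<noteq> 0"
    and g: "g = ev n2 r / ev n2 s" "s \<noteq> 0"
    using assms unfolding tower_field_def by blast
  obtain M1 b1 where M1: "M1 > 0" "\<And>p. ev n1 p = ev (max n1 n2) (stretch M1 b1 p)"
    by (rule ev_lift[of n1 "max n1 n2"]) auto
  obtain M2 b2 where M2: "M2 > 0" "\<And>p. ev n2 p = ev (max n1 n2) (stretch M2 b2 p)"
    by (rule ev_lift[of n2 "max n1 n2"]) auto
  show ?thesis
  proof (rule that)
    show "f = ev (max n1 n2) (stretch M1 b1 p) / ev (max n1 n2) (stretch M1 b1 q)"
      using f M1(2) by simp
    show "g = ev (max n1 n2) (stretch M2 b2 r) / ev (max n1 n2) (stretch M2 b2 s)"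
      using g M2(2) by simp
  qed (use f g M1 M2 stretch_nonzero in auto)
qed

lemma tower_field_add:
  assumes "f \<in> tower_field" "g \<in> tower_field"
  shows "f + g \<in> tower_field"
proof -
  obtain n p q r s where "f = ev n p / ev n q" "g = ev n r / ev n s" and nz: "q \<noteq> 0" "s \<noteq> 0"
    by (rule tower_field_common_level[OF assms])
  then have "f + g = ev n (p * s + r * q) / ev n (q * s)"
    by (simp add: rat_eval_add rat_eval_mult add_frac_eq)
  then show ?thesis
    using nz by (auto intro: tower_fieldI)
qed

lemma tower_field_mult:
  assumes "f \<in> tower_field" "g \<in> tower_field"
  shows "f * g \<in> tower_field"
proof -
  obtain n p q r s where "f = ev n p / ev n q" "g = ev n r / ev n s" and nz: "q \<noteq> 0" "s \<noteq> 0"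
    by (rule tower_field_common_level[OF assms])
  then have "f * g = ev n (p * r) / ev n (q * s)"
    by (simp add: rat_eval_mult)
  then show ?thesis
    using nz by (auto intro: tower_fieldI)
qed

lemma tower_field_inverse:
  assumes "f \<in> tower_field"
  shows "inverse f \<in> tower_field"
proof -
  obtain n p q where f: "f = ev n p / ev n q" "q \<noteq> 0"
    using assms unfolding tower_field_def by blast
  show ?thesis
  proof (cases "p = 0")
    case True
    then show ?thesis using f assms by simp
  next
    case False
    then show ?thesis using tower_fieldI[of p n q] f by simp
  qed
qed

lemma of_rat_in_tower_field: "of_rat c \<in> tower_field"
  using tower_fieldI[of 1 0 "[:c:]"] by (simp add: rat_eval_pCons)

lemma root_tower_in_tower_field: "root_tower x n \<in> tower_field"
  using tower_fieldI[of 1 n "[:0, 1:]"] by (simp add: rat_eval_pCons)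

lemma tower_field_reduced:
  assumes "f \<in> tower_field"
  obtains n p q where "f = ev n p / ev n q" "q \<noteq> 0" "coprime p q"
proof -
  obtain n p q where f: "f = ev n p / ev n q" "q \<noteq> 0"
    using assms unfolding tower_field_def by blast
  have gcd: "gcd p q \<noteq> 0"
    using f(2) by simp
  obtain p' q' where pq: "p = p' * gcd p q" "q = q' * gcd p q" "coprime p' q'"
    using gcd_coprime_exists[OF gcd] by blast
  have "f = (ev n p' * ev n (gcd p q)) / (ev n q' * ev n (gcd p q))"
    using f(1) pq by (metis rat_eval_mult)
  moreover have "ev n (gcd p q) \<noteq> 0"
    using gcd by (simp only: ev_eq_0_iff not_False_eq_True)
  ultimately have "f = ev n p' / ev n q'"
    by (metis mult_divide_mult_cancel_right)
  moreover have "q' \<noteq> 0"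
    using pq(2) f(2) by auto
  ultimately show ?thesis
    using that pq(3) by blast
qed

text \<open>An equation \<open>f = \<plusminus> g^k\<close> becomes, at a level containing both \<open>f\<close> and \<open>g\<close>, an identity
  between powers of reduced fractions. The constant \<open>c\<close> by which the numerator fails to be a
  \<open>k\<close>-th power is common to all its terms and equals that of the denominator up to sign.\<close>

lemma root_gives_common_roots:
  assumes f: "f = ev n p / ev n q" "p \<noteq> 0" "q \<noteq> 0" "coprime p q"
    and low: "lowest_term p cp dp" "lowest_term q cq dq"
    and g: "g \<in> tower_field" "\<bar>g ^ k\<bar> = \<bar>f\<bar>" and "k \<ge> 1"
  shows "common_root n (lead_coeff p) (degree p) cp dp k"
    "common_root n (lead_coeff q) (degree q) cq dq k"
    "common_root n (lead_coeff p) (degree p) (lead_coeff q) (degree q) k"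
proof -
  obtain n' r' s' where g': "g = ev n' r' / ev n' s'" "s' \<noteq> 0" "coprime r' s'"
    by (rule tower_field_reduced[OF g(1)])
  have "f \<noteq> 0" using f by simp
  then have "g \<noteq> 0" using g(2) \<open>k \<ge> 1\<close> by (auto simp: power_0_left)
  then have "r' \<noteq> 0" using g'(1) by auto
  obtain M \<beta> where M: "M > 0" "tower_index (max n n') = tower_index n * M"
    "tower_twist (max n n') = tower_twist n + tower_index n * \<beta>"
    "\<And>p. ev n p = ev (max n n') (stretch M \<beta> p)"
    by (rule ev_lift[of n "max n n'"]) auto
  obtain M' \<beta>' where M': "M' > 0" "\<And>p. ev n' p = ev (max n n') (stretch M' \<beta>' p)"
    by (rule ev_lift[of n' "max n n'"]) auto
  define m where "m = max n n'"
  define P where "P = stretch M \<beta> p"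
  define Q where "Q = stretch M \<beta> q"
  define r where "r = stretch M' \<beta>' r'"
  define s where "s = stretch M' \<beta>' s'"
  note defs = P_def Q_def r_def s_def
  have nz: "P \<noteq> 0" "Q \<noteq> 0" "r \<noteq> 0" "s \<noteq> 0"
    using f g' \<open>r' \<noteq> 0\<close> M(1) M'(1) by (auto simp: defs stretch_nonzero)
  have cop: "coprime P Q" "coprime r s"
    using f g' by (auto simp: defs coprime_stretch)
  have fm: "f = ev m P / ev m Q" and gm: "g = ev m r / ev m s"
    using f(1) g'(1) M(4) M'(2) by (simp_all add: defs m_def)
  obtain \<epsilon> :: rat where \<epsilon>: "\<bar>\<epsilon>\<bar> = 1" "f = of_rat \<epsilon> * g ^ k"
    using g(2) that[of 1] that[of "-1"] by (auto simp: abs_eq_iff)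
  have "ev m P * ev m s ^ k = of_rat \<epsilon> * (ev m Q * ev m r ^ k)"
    using \<epsilon>(2) nz unfolding fm gm by (simp add: field_simps)
  then have "ev m (P * s ^ k) = ev m (smult \<epsilon> (Q * r ^ k))"
    by (simp only: rat_eval_mult rat_eval_power rat_eval_smult)
  then have eq: "P * s ^ k = smult \<epsilon> (Q * r ^ k)"
    by (simp only: ev_eq_iff)
  have "\<epsilon> \<noteq> 0" using \<epsilon>(1) by auto
  obtain c where c: "c \<noteq> 0" "P = smult c (r ^ k)" "Q = smult (c / \<epsilon>) (s ^ k)"
    by (rule coprime_power_equation[OF cop nz(1,3,4) eq \<open>\<epsilon> \<noteq> 0\<close>])
  have "c / \<epsilon> \<noteq> 0" using c \<open>\<epsilon> \<noteq> 0\<close> by simp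
  obtain r1 e1 r2 e2 where r: "r1 \<noteq> 0" "r2 \<noteq> 0" "M * degree p = k * e1" "M * dp = k * e2"
    "lead_coeff p * (1 / 2) ^ (\<beta> * degree p) = c * r1 ^ k" "cp * (1 / 2) ^ (\<beta> * dp) = c * r2 ^ k"
    by (rule stretch_power_terms[OF c(2)[unfolded defs(1)] M(1) nz(3) c(1) low(1)])
  obtain s1 l1 s2 l2 where s: "s1 \<noteq> 0" "s2 \<noteq> 0" "M * degree q = k * l1" "M * dq = k * l2"
    "lead_coeff q * (1 / 2) ^ (\<beta> * degree q) = c / \<epsilon> * s1 ^ k"
    "cq * (1 / 2) ^ (\<beta> * dq) = c / \<epsilon> * s2 ^ k"
    by (rule stretch_power_terms[OF c(3)[unfolded defs(2)] M(1) nz(4) \<open>c / \<epsilon> \<noteq> 0\<close> low(2)])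
  have abs: "\<bar>c\<bar> = \<bar>c / \<epsilon>\<bar>"
    using \<epsilon>(1) by (simp add: abs_divide)
  show "common_root n (lead_coeff p) (degree p) cp dp k"
    unfolding common_root_def using M(2,3) c(1) r by blast
  show "common_root n (lead_coeff q) (degree q) cq dq k"
    unfolding common_root_def using M(2,3) \<open>c / \<epsilon> \<noteq> 0\<close> s by blast
  show "common_root n (lead_coeff p) (degree p) (lead_coeff q) (degree q) k"
    unfolding common_root_def using M(2,3) c(1) abs r s by blast
qed

lemma finite_roots_in_tower_field:
  assumes "f \<in> tower_field" "f \<noteq> 0" "\<bar>f\<bar> \<noteq> 1"
  shows "finite {k. k \<ge> 1 \<and> (\<exists>g\<in>tower_field. \<bar>g ^ k\<bar> = \<bar>f\<bar>)}"
proof -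
  obtain n p q where f: "f = ev n p / ev n q" "q \<noteq> 0" "coprime p q"
    by (rule tower_field_reduced[OF assms(1)])
  have "p \<noteq> 0" using f assms(2) by auto
  obtain cp dp where lp: "lowest_term p cp dp"
    using lowest_term_exists[OF \<open>p \<noteq> 0\<close>] by blast
  obtain cq dq where lq: "lowest_term q cq dq"
    using lowest_term_exists[OF f(2)] by blast
  have nz: "lead_coeff p \<noteq> 0" "lead_coeff q \<noteq> 0" "cp \<noteq> 0" "cq \<noteq> 0"
    using \<open>p \<noteq> 0\<close> f(2) lp lq by (auto simp: lowest_term_def)
  note roots = root_gives_common_roots[OF f(1) \<open>p \<noteq> 0\<close> f(2,3) lp lq]
  have "\<not> (degree p = dp \<and> \<bar>lead_coeff p\<bar> = \<bar>cp\<bar>) \<or> \<not> (degree q = dq \<and> \<bar>lead_coeff q\<bar> = \<bar>cq\<bar>)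
    \<or> \<not> (degree p = degree q \<and> \<bar>lead_coeff p\<bar> = \<bar>lead_coeff q\<bar>)"
  proof (rule ccontr)
    assume "\<not> ?thesis"
    then have d: "degree p = dp" "degree q = dq" "degree p = degree q"
      and l: "\<bar>lead_coeff p\<bar> = \<bar>lead_coeff q\<bar>"
      by auto
    have "p = monom (lead_coeff p) (degree p)" "q = monom (lead_coeff q) (degree p)"
      using lowest_term_degree[OF lp d(1)] lowest_term_degree[OF lq d(2)] d(3) by simp_all
    then have "ev n p = of_rat (lead_coeff p) * root_tower x n ^ degree p"
      "ev n q = of_rat (lead_coeff q) * root_tower x n ^ degree p"
      by (metis rat_eval_monom)+
    moreover have "\<bar>of_rat (lead_coeff p) :: real\<bar> = \<bar>of_rat (lead_coeff q)\<bar>"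
      using l by (auto simp: abs_eq_iff of_rat_minus)
    ultimately have "\<bar>ev n p\<bar> = \<bar>ev n q\<bar>"
      by (simp add: abs_mult)
    then have "\<bar>f\<bar> = 1"
      using f by (simp add: abs_divide)
    with assms(3) show False by simp
  qed
  then consider "finite {k. k \<ge> 1 \<and> common_root n (lead_coeff p) (degree p) cp dp k}"
    | "finite {k. k \<ge> 1 \<and> common_root n (lead_coeff q) (degree q) cq dq k}"
    | "finite {k. k \<ge> 1 \<and> common_root n (lead_coeff p) (degree p) (lead_coeff q) (degree q) k}"
    using finite_common_roots nz by metis
  then show ?thesis
  proof cases
    case 1
    then show ?thesis by (rule rev_finite_subset) (use roots(1) in auto)
  next
    case 2
    then show ?thesis by (rule rev_finite_subset) (use roots(2) in auto)
  next
    case 3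
    then show ?thesis by (rule rev_finite_subset) (use roots(3) in auto)
  qed
qed

end

section \<open>Copying a field of real numbers\<close>

text \<open>The Dedekind cut of a real number, with the rationals numbered. It moves a field of real
  numbers to the type of sets of natural numbers.\<close>

definition real_code :: "real \<Rightarrow> nat set" where
  "real_code r = {n. of_rat (from_nat n) < r}"

lemma inj_real_code: "inj real_code"
proof (rule linorder_injI)
  fix r s :: real assume "r < s"
  then obtain q where "r < of_rat q" "of_rat q < s"
    using of_rat_dense by blast
  then have "to_nat q \<in> real_code s" "to_nat q \<notin> real_code r"
    by (simp_all add: real_code_def)
  then show "real_code r \<noteq> real_code s" by blast
qed

abbreviation real_decode :: "nat set \<Rightarrow> real" where
  "real_decode \<equiv> inv_into UNIV real_code"

lemma decode_code [simp]: "real_decode (real_code r) = r"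
  using inj_real_code by simp

lemma real_code_eq_iff [simp]: "real_code r = real_code s \<longleftrightarrow> r = s"
  using inj_real_code by (auto dest: injD)

definition coded_field :: "real set \<Rightarrow> nat set ring" where
  "coded_field K = \<lparr>carrier = real_code ` K,
     monoid.mult = (\<lambda>a b. real_code (real_decode a * real_decode b)), one = real_code 1,
     zero = real_code 0, add = (\<lambda>a b. real_code (real_decode a + real_decode b))\<rparr>"

locale real_subfield =
  fixes K :: "real set"
  assumes one_in: "1 \<in> K"
    and add_in: "r \<in> K \<Longrightarrow> s \<in> K \<Longrightarrow> r + s \<in> K"
    and uminus_in: "r \<in> K \<Longrightarrow> - r \<in> K"
    and mult_in: "r \<in> K \<Longrightarrow> s \<in> K \<Longrightarrow> r * s \<in> K"
    and inverse_in: "r \<in> K \<Longrightarrow> inverse r \<in> K"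
begin

abbreviation F :: "nat set ring" where
  "F \<equiv> coded_field K"

lemma zero_in: "0 \<in> K"
  using add_in[OF one_in uminus_in[OF one_in]] by simp

lemma coded_simps [simp]:
  "carrier F = real_code ` K" "\<one>\<^bsub>F\<^esub> = real_code 1" "\<zero>\<^bsub>F\<^esub> = real_code 0"
  "real_code r \<otimes>\<^bsub>F\<^esub> real_code s = real_code (r * s)"
  "real_code r \<oplus>\<^bsub>F\<^esub> real_code s = real_code (r + s)"
  by (simp_all add: coded_field_def)

lemma cring_coded: "cring F"
proof (rule cringI)
  show "abelian_group F"
  proof (rule abelian_groupI)
    fix a assume "a \<in> carrier F"
    then obtain r where "r \<in> K" "a = real_code r" by auto
    then show "\<exists>y\<in>carrier F. y \<oplus>\<^bsub>F\<^esub> a = \<zero>\<^bsub>F\<^esub>"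
      by (intro bexI[of _ "real_code (- r)"]) (auto intro: uminus_in)
  qed (auto simp: add_in zero_in algebra_simps)
  show "comm_monoid F"
    by (rule comm_monoidI) (auto simp: mult_in one_in mult_ac)
qed (auto simp: algebra_simps)

lemma field_coded: "field F"
proof -
  interpret cring F by (rule cring_coded)
  have "a \<in> Units F" if a: "a \<in> carrier F - {\<zero>\<^bsub>F\<^esub>}" for a
  proof -
    obtain r where r: "r \<in> K" "a = real_code r"
      using a unfolding coded_simps by blast
    then have "r \<noteq> 0"
      using a by simp
    then have "real_code (inverse r) \<otimes>\<^bsub>F\<^esub> a = \<one>\<^bsub>F\<^esub>" "a \<otimes>\<^bsub>F\<^esub> real_code (inverse r) = \<one>\<^bsub>F\<^esub>"
      using r(2) by simp_all
    moreover have "real_code (inverse r) \<in> carrier F"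
      using inverse_in[OF r(1)] by simp
    ultimately show ?thesis
      using a unfolding Units_def by blast
  qed
  moreover have "\<zero>\<^bsub>F\<^esub> \<notin> Units F"
  proof
    assume "\<zero>\<^bsub>F\<^esub> \<in> Units F"
    then obtain b where "b \<in> carrier F" "b \<otimes>\<^bsub>F\<^esub> \<zero>\<^bsub>F\<^esub> = \<one>\<^bsub>F\<^esub>"
      unfolding Units_def by blast
    then show False
      by (metis coded_simps(2,3) r_null real_code_eq_iff zero_neq_one)
  qed
  ultimately have "Units F = carrier F - {\<zero>\<^bsub>F\<^esub>}"
    using Units_closed by blast
  then show ?thesis
    by (rule cring_fieldI)
qed

lemma coded_power: "real_code r [^]\<^bsub>F\<^esub> (n::nat) = real_code (r ^ n)"
  by (induction n) (simp_all add: nat_pow_def mult.commute)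

lemma roots_of_unity_coded: "roots_of_unity F = {real_code 1, real_code (- 1)}"
proof
  show "roots_of_unity F \<subseteq> {real_code 1, real_code (- 1)}"
  proof
    fix a assume "a \<in> roots_of_unity F"
    then obtain r and n :: nat
      where r: "a = real_code r" "n \<ge> 1" "a [^]\<^bsub>F\<^esub> n = \<one>\<^bsub>F\<^esub>"
      unfolding roots_of_unity_def coded_simps by blast
    then have "r ^ n = 1"
      by (simp add: coded_power)
    then have "\<bar>r\<bar> = 1"
      using r(2) power_eq_1_iff[of r n] by simp
    then show "a \<in> {real_code 1, real_code (- 1)}"
      using r(1) by (simp add: abs_if split: if_splits; metis minus_minus)
  qed
  have "real_code r \<in> roots_of_unity F" if "r \<in> K" "r ^ 2 = 1" for r
    using that unfolding roots_of_unity_def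
    by (simp add: coded_power) (intro exI[of _ 2], simp)
  then show "{real_code 1, real_code (- 1)} \<subseteq> roots_of_unity F"
    using one_in uminus_in[OF one_in] by simp
qed

lemma rootless_coded:
  assumes "\<And>f. f \<in> K \<Longrightarrow> f \<noteq> 0 \<Longrightarrow> \<bar>f\<bar> \<noteq> 1 \<Longrightarrow> finite {k. k \<ge> 1 \<and> (\<exists>g\<in>K. \<bar>g ^ k\<bar> = \<bar>f\<bar>)}"
  shows "rootless_modtor F"
  unfolding rootless_modtor_def
proof (intro ballI impI)
  fix a assume a: "a \<in> carrier F" "a \<noteq> \<zero>\<^bsub>F\<^esub>" "a \<notin> roots_of_unity F"
  obtain f where f: "f \<in> K" "a = real_code f"
    using a(1) unfolding coded_simps by blast
  have nz: "f \<noteq> 0" "\<bar>f\<bar> \<noteq> 1"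
    using a(2,3) f(2) by (simp_all add: roots_of_unity_coded abs_eq_iff')
  have "{n. n \<ge> 1 \<and> \<not> (\<forall>\<zeta>\<in>roots_of_unity F. \<not> (\<exists>b\<in>carrier F. b [^]\<^bsub>F\<^esub> n = \<zeta> \<otimes>\<^bsub>F\<^esub> a))}
    \<subseteq> {k. k \<ge> 1 \<and> (\<exists>g\<in>K. \<bar>g ^ k\<bar> = \<bar>f\<bar>)}"
  proof
    fix n :: nat assume "n \<in> {n. n \<ge> 1 \<and>
      \<not> (\<forall>\<zeta>\<in>roots_of_unity F. \<not> (\<exists>b\<in>carrier F. b [^]\<^bsub>F\<^esub> n = \<zeta> \<otimes>\<^bsub>F\<^esub> a))}"
    then obtain \<zeta> b where n: "n \<ge> 1" and \<zeta>: "\<zeta> \<in> roots_of_unity F"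
      and b: "b \<in> carrier F" "b [^]\<^bsub>F\<^esub> n = \<zeta> \<otimes>\<^bsub>F\<^esub> a"
      by blast
    obtain g where g: "g \<in> K" "b = real_code g"
      using b(1) unfolding coded_simps by blast
    from \<zeta> consider "\<zeta> = real_code 1" | "\<zeta> = real_code (- 1)"
      unfolding roots_of_unity_coded by blast
    then have "\<bar>g ^ n\<bar> = \<bar>f\<bar>"
      using b(2) by cases (simp_all add: g(2) f(2) coded_power)
    with n g(1) show "n \<in> {k. k \<ge> 1 \<and> (\<exists>g\<in>K. \<bar>g ^ k\<bar> = \<bar>f\<bar>)}"
      by blast
  qed
  then show "rootless_modtor_elem F a"
    unfolding rootless_modtor_elem_def using a assms[OF f(1) nz] finite_subset by blast
qed

end

section \<open>Integer characters of free abelian groups\<close>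

text \<open>The coordinates with respect to a basis are homomorphisms to the integers.\<close>

lemma free_abelian_separated:
  assumes "free_abelian G" "group G" "g \<in> carrier G" "g \<noteq> \<one>\<^bsub>G\<^esub>"
  shows "\<exists>c \<in> hom G integer_group. c g \<noteq> 0"
proof -
  obtain S :: "'a set" and h where h: "h \<in> Group.iso G (free_Abelian_group S)"
    using assms(1) by (auto simp: free_abelian_def is_iso_def)
  then have hom: "h \<in> hom G (free_Abelian_group S)" and inj: "inj_on h (carrier G)"
    by (auto simp: Group.iso_def bij_betw_def)
  have "h \<one>\<^bsub>G\<^esub> = 0"
    using hom_one[OF hom assms(2)] by simp
  then have "h g \<noteq> 0"
    using inj assms(2-4) by (metis group.is_monoid inj_onD monoid.one_closed)
  then obtain s where s: "Poly_Mapping.lookup (h g) s \<noteq> 0"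
    by (metis lookup_zero poly_mapping_eqI)
  have "(\<lambda>a. Poly_Mapping.lookup (h a) s) \<in> hom G integer_group"
  proof (rule homI)
    fix a b assume "a \<in> carrier G" "b \<in> carrier G"
    then show "Poly_Mapping.lookup (h (a \<otimes>\<^bsub>G\<^esub> b)) s
        = Poly_Mapping.lookup (h a) s \<otimes>\<^bsub>integer_group\<^esub> Poly_Mapping.lookup (h b) s"
      using hom_mult[OF hom] by (simp add: lookup_add)
  qed simp
  with s show ?thesis by (intro bexI[where x = "\<lambda>a. Poly_Mapping.lookup (h a) s"])
qed

text \<open>A homomorphism to the integers turns the relation at level \<open>n\<close> into a congruence modulo
  \<open>tower_index n\<close>, and \<open>tower_twist_irrational\<close> applies to these congruences.\<close>

lemma twisted_root_character_zero:
  assumes "group G" and hom: "c \<in> hom G integer_group"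
    and "a \<in> carrier G" "b \<in> carrier G" "\<And>n. z n \<in> carrier G"
    and z: "\<And>n. z n [^]\<^bsub>G\<^esub> tower_index n = a \<otimes>\<^bsub>G\<^esub> b [^]\<^bsub>G\<^esub> tower_twist n"
  shows "c b = 0"
proof -
  interpret group G by fact
  interpret c: group_hom G integer_group c
    using hom by (simp add: group_hom_def group_hom_axioms_def is_group group_integer_group)
  have pow: "c (y [^]\<^bsub>G\<^esub> (n::nat)) = int n * c y" if "y \<in> carrier G" for y n
    using that by (induction n) (simp_all add: algebra_simps)
  have "- c b = 0"
  proof (rule tower_twist_irrational)
    fix t :: nat
    have "int (tower_index t) * c (z t) = c a + int (tower_twist t) * c b"
      using arg_cong[OF z[of t], of c] assms(3-5) by (simp add: pow)
    then have "c a - (- c b) * int (tower_twist t) = int (tower_index t) * c (z t)"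
      by (simp add: algebra_simps)
    then show "int (tower_index t) dvd c a - (- c b) * int (tower_twist t)"
      by simp
  qed
  then show ?thesis by simp
qed

section \<open>The counterexample\<close>

context generic_tower
begin

sublocale real_subfield tower_field
proof
  show "1 \<in> tower_field"
    using of_rat_in_tower_field[of 1] by simp
  show "- r \<in> tower_field" if "r \<in> tower_field" for r
    using tower_field_mult[OF of_rat_in_tower_field[of "- 1"] that] by simp
qed (fact tower_field_add tower_field_mult tower_field_inverse)+

lemma rootless_tower_field: "rootless_modtor F"
  by (rule rootless_coded) (rule finite_roots_in_tower_field)

lemma not_free_tower_field: "\<not> free_abelian (units_of F Mod roots_of_unity F)"
proof
  assume free: "free_abelian (units_of F Mod roots_of_unity F)"
  interpret field F by (rule field_coded)
  interpret U: comm_group "units_of F" by (rule units_comm_group)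
  interpret N: normal "roots_of_unity F" "units_of F" by (rule roots_of_unity_normal)
  let ?Q = "units_of F Mod roots_of_unity F"
  let ?\<pi> = "\<lambda>a. roots_of_unity F #>\<^bsub>units_of F\<^esub> a"
  have \<pi>: "?\<pi> \<in> hom (units_of F) ?Q"
    by (rule N.r_coset_hom_Mod)
  have unit: "real_code r \<in> carrier (units_of F)" if "r \<in> tower_field" "r \<noteq> 0" for r
    using that by (simp add: units_of_carrier field_Units)
  have z: "real_code (root_tower x n) \<in> carrier (units_of F)" for n
    using root_tower_pos[OF x_pos, of n] by (intro unit root_tower_in_tower_field) simp
  have two: "real_code 2 \<in> carrier (units_of F)"
    using of_rat_in_tower_field[of 2] by (intro unit) simp_all
  have "?\<pi> (real_code 2) \<noteq> \<one>\<^bsub>?Q\<^esub>"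
  proof
    assume "?\<pi> (real_code 2) = \<one>\<^bsub>?Q\<^esub>"
    then have "real_code 2 \<in> roots_of_unity F"
      using U.coset_join1[OF _ two N.subgroup_axioms] N.subset by (simp add: FactGroup_def)
    then show False
      by (simp add: roots_of_unity_coded)
  qed
  then obtain c where c: "c \<in> hom ?Q integer_group" "c (?\<pi> (real_code 2)) \<noteq> 0"
    using free_abelian_separated[OF free N.factorgroup_is_group] hom_in_carrier[OF \<pi> two] by blast
  have "(c \<circ> ?\<pi>) (real_code 2) = 0"
  proof (rule twisted_root_character_zero[OF U.is_group])
    show "c \<circ> ?\<pi> \<in> hom (units_of F) integer_group"
      by (rule hom_compose[OF \<pi> c(1)])
    fix n
    show "real_code (root_tower x n) [^]\<^bsub>units_of F\<^esub> tower_index n =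
        real_code (root_tower x 0) \<otimes>\<^bsub>units_of F\<^esub> real_code 2 [^]\<^bsub>units_of F\<^esub> tower_twist n"
      using root_tower_power[OF x_pos, of n]
      by (simp add: units_of_nat_pow units_of_mult coded_power)
  qed (use z two in blast)+
  with c(2) show False by simp
qed

end

theorem mainTheorem9:
  shows "\<exists>F :: nat set ring.
           field F \<and> rootless_modtor F \<and>
           \<not> free_abelian (units_of F Mod roots_of_unity F)"
proof -
  obtain x where "x > 0" "\<And>n p. rat_eval (root_tower x n) p = 0 \<Longrightarrow> p = 0"
    using generic_base_exists by blast
  then interpret generic_tower x
    by unfold_locales
  show ?thesis
    using field_coded rootless_tower_field not_free_tower_field by blast
qed

end
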